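(* Let $G$ be a connected graph of order $n\ge 2$ and let $H$ be any graph. If $n>\beta(H)\ge 2$, then $pd(G\odot H)\ge \beta(H)+1$.
   Context: $\beta(H)$ denotes the number of isolated vertices of $H$. For a connected graph $F$ and an ordered partition $\Pi=\{P_1,\dots,P_t\}$ of $V(F)$, $r(v|\Pi)=(d(v,P_1),\dots,d(v,P_t))$ where $d$ is shortest-path distance and $d(v,P_i)=\min_{u\in P_i}d(v,u)$; $\Pi$ is a resolving partition if $r(u|\Pi)\ne r(v|\Pi)$ for all distinct vertices $u,v$; $pd(F)$ is the minimum number of sets in a resolving partition. For graphs $G$ of order $n_1$ (vertices $v_1,\dots,v_{n_1}$) and $H$, the corona product $G\odot H$ is obtained from one copy of $G$ and $n_1$ copies $H_1,\dots,H_{n_1}$ of $H$ by joining $v_i$ to every vertex of $H_i$. *)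

theory Defs
  imports "Graph_Theory.Graph_Theory" "HOL-Library.Disjoint_Sets"
begin

text \<open>
  A finite simple graph is a \<^term>\<open>pair_graph\<close>: a finite, symmetric, loop-free
  digraph without parallel arcs, so that an undirected edge is a pair of opposite arcs.
\<close>

definition gdist :: "'a pair_pre_digraph \<Rightarrow> 'a \<Rightarrow> 'a \<Rightarrow> ereal" where
  "gdist F u v = wf_digraph.\<mu> (with_proj F) (\<lambda>_. 1) u v"

definition set_dist :: "'a pair_pre_digraph \<Rightarrow> 'a \<Rightarrow> 'a set \<Rightarrow> ereal" where
  "set_dist F v P = Min ((\<lambda>u. gdist F v u) ` P)"

definition partition_repr :: "'a pair_pre_digraph \<Rightarrow> 'a set list \<Rightarrow> 'a \<Rightarrow> ereal list" where
  "partition_repr F Ps v = map (set_dist F v) Ps"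

definition ordered_partition :: "'a set \<Rightarrow> 'a set list \<Rightarrow> bool" where
  "ordered_partition V Ps \<longleftrightarrow> distinct Ps \<and> partition_on V (set Ps)"

definition resolving_partition :: "'a pair_pre_digraph \<Rightarrow> 'a set list \<Rightarrow> bool" where
  "resolving_partition F Ps \<longleftrightarrow>
     ordered_partition (pverts F) Ps \<and>
     (\<forall>u \<in> pverts F. \<forall>v \<in> pverts F. u \<noteq> v \<longrightarrow> partition_repr F Ps u \<noteq> partition_repr F Ps v)"

text \<open>
  The minimum below is attained for every finite graph: see the lemma
  \<open>resolving_partition_exists\<close>.
\<close>

definition partition_dimension :: "'a pair_pre_digraph \<Rightarrow> nat" where
  "partition_dimension F = (LEAST t. \<exists>Ps. resolving_partition F Ps \<and> length Ps = t)"

definition isolated_verts :: "'a pair_pre_digraph \<Rightarrow> 'a set" where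
  "isolated_verts H =
     {v \<in> pverts H. in_arcs (with_proj H) v = {} \<and> out_arcs (with_proj H) v = {}}"

definition num_isolated :: "'a pair_pre_digraph \<Rightarrow> nat" where
  "num_isolated H = card (isolated_verts H)"

text \<open>
  \<open>Inl v\<close> is the vertex \<open>v\<close> of the copy of \<open>G\<close>, and \<open>Inr (v, x)\<close> is the vertex \<open>x\<close> of the
  copy of \<open>H\<close> attached to \<open>v\<close>.
\<close>

definition corona ::
  "'a pair_pre_digraph \<Rightarrow> 'b pair_pre_digraph \<Rightarrow> ('a + 'a \<times> 'b) pair_pre_digraph" where
  "corona G H = \<lparr>
     pverts = Inl ` pverts G \<union> Inr ` (pverts G \<times> pverts H),
     parcs =
       {(Inl u, Inl v) | u v. (u, v) \<in> parcs G} \<union>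
       {(Inr (v, x), Inr (v, y)) | v x y. v \<in> pverts G \<and> (x, y) \<in> parcs H} \<union>
       {(Inl v, Inr (v, x)) | v x. v \<in> pverts G \<and> x \<in> pverts H} \<union>
       {(Inr (v, x), Inl v) | v x. v \<in> pverts G \<and> x \<in> pverts H} \<rparr>"

lemma pair_graph_corona:
  assumes "pair_graph G" "pair_graph H"
  shows "pair_graph (corona G H)"
proof -
  interpret G: pair_graph G by fact
  interpret H: pair_graph H by fact
  have wf: "parcs (corona G H) \<subseteq> pverts (corona G H) \<times> pverts (corona G H)"
    by (auto simp: corona_def dest: G.wellformed' H.wellformed')
  have fin: "finite (pverts (corona G H))"
    by (simp add: corona_def G.pair_finite_verts H.pair_finite_verts)
  have sym: "sym (parcs (corona G H))"
    using G.pair_sym_arcs H.pair_sym_arcs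
    by (auto simp: corona_def symmetric_def sym_def)
  show ?thesis
  proof
    show "finite (parcs (corona G H))"
      using wf fin by (meson finite_SigmaI finite_subset)
    show "symmetric (with_proj (corona G H))"
      using sym by (simp add: symmetric_def)
    show "fst e \<noteq> snd e" if "e \<in> parcs (corona G H)" for e
      using that by (auto simp: corona_def dest: G.pair_no_loops H.pair_no_loops)
  qed (use wf fin in auto)
qed

lemma resolving_partition_exists:
  assumes "pair_graph F"
  shows "\<exists>Ps. resolving_partition F Ps"
proof -
  interpret F: pair_graph F by fact
  obtain vs where vs: "set vs = pverts F" "distinct vs"
    using F.pair_finite_verts finite_distinct_list by blast
  let ?Ps = "map (\<lambda>v. {v}) vs"
  have refl: "gdist F v v = 0" if "v \<in> pverts F" for v
  proof (rule antisym)
    have "F.awalk v [] v" using that by (simp add: F.awalk_Nil_iff)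
    then show "gdist F v v \<le> 0"
      unfolding gdist_def using F.min_cost_le_walk_cost[of v "[]" v "\<lambda>_. 1"]
      by (simp add: zero_ereal_def)
    show "0 \<le> gdist F v v"
      unfolding gdist_def F.\<mu>_def
      by (auto intro!: INF_greatest F.pos_cost_pos_awalk_cost)
  qed
  have pos: "gdist F u v \<noteq> 0" if "u \<noteq> v" for u v
  proof -
    have len: "F.awalk_cost (\<lambda>_. 1) p = real (length p)" for p
      by (induct p) (auto simp: F.awalk_cost_Cons)
    have "1 \<le> gdist F u v"
      unfolding gdist_def F.\<mu>_def
    proof (rule INF_greatest)
      fix p assume "p \<in> {p. F.awalk u p v}"
      then have "p \<noteq> []" using that by (auto simp: F.awalk_Nil_iff)
      then have "1 \<le> length p" by (cases p) auto
      then show "1 \<le> ereal (F.awalk_cost (\<lambda>_. 1) p)"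
        by (simp add: len one_ereal_def)
    qed
    then show ?thesis by auto
  qed
  have "ordered_partition (pverts F) ?Ps"
    using vs by (auto simp: ordered_partition_def partition_on_def disjoint_def distinct_map)
  moreover have "partition_repr F ?Ps u \<noteq> partition_repr F ?Ps v"
    if "u \<in> pverts F" "v \<in> pverts F" "u \<noteq> v" for u v
  proof
    assume "partition_repr F ?Ps u = partition_repr F ?Ps v"
    then have "gdist F u u = gdist F v u"
      using that vs by (simp add: partition_repr_def set_dist_def)
    then show False using refl pos that by metis
  qed
  ultimately show ?thesis unfolding resolving_partition_def by blast
qed

end

theory Submission
  imports Defs
begin

text \<open>
  Two isolated vertices in the same copy of \<open>H\<close> have the same neighbourhood, so a resolving
  partition puts them into distinct classes. With only \<open>\<beta>(H)\<close> classes, every class would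
  therefore meet every copy of \<open>H\<close>, so each vertex of \<open>G\<close> would be at distance \<open>0\<close> from its own
  class and at distance \<open>1\<close> from all the others. Since \<open>n > \<beta>(H)\<close>, two vertices of \<open>G\<close> share a
  class and would have the same representation.
\<close>

context pair_graph
begin

lemma awalk_cost_one: "awalk_cost (\<lambda>_. 1) p = real (length p)"
  by (induct p) (auto simp: awalk_cost_Cons)

lemma gdist_le_awalk_length: "awalk u p v \<Longrightarrow> gdist G u v \<le> ereal (real (length p))"
  using min_cost_le_walk_cost[of u p v "\<lambda>_. 1"] by (simp add: gdist_def awalk_cost_one)

text \<open>\<open>gdist\<close> is an infimum over walks, so a lower bound on the lengths of all
  walks passes to it. If there is no walk, the premise is vacuous and the distance is
  infinite.\<close>

lemma gdist_greatest:
  assumes "\<And>p. awalk u p v \<Longrightarrow> c \<le> ereal (real (length p))"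
  shows "c \<le> gdist G u v"
  unfolding gdist_def \<mu>_def using assms by (auto intro!: INF_greatest simp: awalk_cost_one)

lemma gdist_nonneg: "0 \<le> gdist G u v"
  by (rule gdist_greatest) simp

lemma gdist_self: "v \<in> pverts G \<Longrightarrow> gdist G v v = 0"
  using gdist_le_awalk_length[of v "[]" v] gdist_nonneg[of v v]
  by (simp add: awalk_Nil_iff zero_ereal_def[symmetric])

lemma gdist_ge_one: "u \<noteq> v \<Longrightarrow> 1 \<le> gdist G u v"
proof (rule gdist_greatest)
  fix p assume "u \<noteq> v" "awalk u p v"
  then have "p \<noteq> []" by (auto simp: awalk_Nil_iff)
  then show "1 \<le> ereal (real (length p))"
    by (cases p) (auto simp: one_ereal_def)
qed

lemma gdist_arc:
  assumes "(u, v) \<in> parcs G"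
  shows "gdist G u v = 1"
proof (rule antisym)
  have "awalk u [(u, v)] v"
    using arc_implies_awalk[of "(u, v)"] assms by simp
  then show "gdist G u v \<le> 1"
    using gdist_le_awalk_length[of u "[(u, v)]" v] by (simp add: one_ereal_def)
  show "1 \<le> gdist G u v"
    using pair_no_loops[OF assms] by (intro gdist_ge_one) simp
qed

text \<open>A walk from \<open>x\<close> turns into a walk from \<open>y\<close> of the same length
  when its first arc is replaced by the arc from \<open>y\<close> to the second vertex. The
  condition \<open>u \<noteq> x\<close> rules out the empty walk, which has no first arc.\<close>

lemma gdist_mono_neighbourhood:
  assumes "\<And>w. (x, w) \<in> parcs G \<Longrightarrow> (y, w) \<in> parcs G" and "u \<noteq> x"
  shows "gdist G y u \<le> gdist G x u"
proof (rule gdist_greatest)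
  fix p assume p: "awalk x p u"
  with assms(2) obtain e q where eq: "p = e # q"
    by (cases p) (auto simp: awalk_Nil_iff)
  with p have e: "e \<in> parcs G" "fst e = x" and q: "awalk (snd e) q u"
    by (auto simp: awalk_Cons_iff)
  then have "(y, snd e) \<in> parcs G"
    using assms(1) by (metis prod.collapse)
  with q have "awalk y ((y, snd e) # q) u"
    by (auto simp: awalk_Cons_iff)
  from gdist_le_awalk_length[OF this] show "gdist G y u \<le> ereal (real (length p))"
    by (simp add: eq)
qed

lemma gdist_twins:
  assumes "\<And>w. (x, w) \<in> parcs G \<longleftrightarrow> (y, w) \<in> parcs G" "u \<noteq> x" "u \<noteq> y"
  shows "gdist G x u = gdist G y u"
proof (rule antisym)
  show "gdist G x u \<le> gdist G y u"
    using assms(1,3) by (intro gdist_mono_neighbourhood) simp_all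
  show "gdist G y u \<le> gdist G x u"
    using assms(1,2) by (intro gdist_mono_neighbourhood) simp_all
qed

text \<open>\<open>Min\<close> needs a finite set; \<open>P \<subseteq> pverts G\<close> provides
  this. The minimum is attained at \<open>v\<close> itself.\<close>

lemma set_dist_mem:
  assumes "P \<subseteq> pverts G" "v \<in> P"
  shows "set_dist G v P = 0"
  unfolding set_dist_def
proof (rule Min_eqI)
  show "finite (gdist G v ` P)"
    using finite_subset[OF assms(1) pair_finite_verts] by (rule finite_imageI)
  show "0 \<le> y" if "y \<in> gdist G v ` P" for y
    using that gdist_nonneg by auto
  show "0 \<in> gdist G v ` P"
    using gdist_self[of v, symmetric] assms by (intro image_eqI[of _ _ v]) auto
qed

lemma set_dist_neighbour:
  assumes "P \<subseteq> pverts G" "v \<notin> P" "u \<in> P" "(v, u) \<in> parcs G"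
  shows "set_dist G v P = 1"
  unfolding set_dist_def
proof (rule Min_eqI)
  show "finite (gdist G v ` P)"
    using finite_subset[OF assms(1) pair_finite_verts] by (rule finite_imageI)
  show "1 \<le> y" if "y \<in> gdist G v ` P" for y
  proof -
    from that obtain w where "w \<in> P" "y = gdist G v w" by (rule imageE)
    with assms(2) show ?thesis by (metis gdist_ge_one)
  qed
  show "1 \<in> gdist G v ` P"
    using gdist_arc[OF assms(4), symmetric] assms(3) by (rule image_eqI)
qed

text \<open>Twins have equal distances to every vertex other than themselves. A shared class would
  be at distance 0 from both, and any other class contains neither of them, so no class could tell
  them apart.\<close>

lemma resolving_partition_separates_twins:
  assumes res: "resolving_partition G Ps"
    and twins: "\<And>w. (x, w) \<in> parcs G \<longleftrightarrow> (y, w) \<in> parcs G"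
    and xy: "x \<in> pverts G" "y \<in> pverts G" "x \<noteq> y"
    and P: "P \<in> set Ps" "x \<in> P"
  shows "y \<notin> P"
proof
  assume y: "y \<in> P"
  have part: "partition_on (pverts G) (set Ps)"
    using res by (simp add: resolving_partition_def ordered_partition_def)
  have "set_dist G x Q = set_dist G y Q" if Q: "Q \<in> set Ps" for Q
  proof (cases "Q = P")
    case True
    have "P \<subseteq> pverts G"
      using part P(1) by (auto simp: partition_on_def)
    with True P(2) y show ?thesis by (simp add: set_dist_mem)
  next
    case False
    then have "P \<inter> Q = {}"
      using part P(1) Q by (auto simp: partition_on_def disjoint_def)
    with P(2) y have "gdist G x u = gdist G y u" if "u \<in> Q" for u
      using that by (intro gdist_twins[OF twins]) auto
    then show ?thesis by (simp add: set_dist_def cong: image_cong)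
  qed
  then have "partition_repr G Ps x = partition_repr G Ps y"
    by (simp add: partition_repr_def)
  with res xy show False by (auto simp: resolving_partition_def)
qed

text \<open>A vertex with a neighbour in every class has entry 0 at its own class and 1 everywhere
  else, so its class alone determines its representation.\<close>

lemma resolving_partition_separates_dominating:
  assumes res: "resolving_partition G Ps"
    and xy: "x \<in> pverts G" "y \<in> pverts G" "x \<noteq> y"
    and dom: "\<And>Q z. Q \<in> set Ps \<Longrightarrow> z \<in> {x, y} \<Longrightarrow> \<exists>u\<in>Q. (z, u) \<in> parcs G"
    and P: "P \<in> set Ps" "x \<in> P"
  shows "y \<notin> P"
proof
  assume y: "y \<in> P"
  have part: "partition_on (pverts G) (set Ps)"
    using res by (simp add: resolving_partition_def ordered_partition_def)
  have "set_dist G z Q = (if Q = P then 0 else 1)" if Q: "Q \<in> set Ps" and z: "z \<in> {x, y}" for Q z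
  proof -
    have sub: "Q \<subseteq> pverts G" using part Q by (auto simp: partition_on_def)
    have zP: "z \<in> P" using P(2) y z by auto
    show ?thesis
    proof (cases "Q = P")
      case True
      with sub zP show ?thesis by (simp add: set_dist_mem)
    next
      case False
      then have "z \<notin> Q"
        using part P(1) Q zP by (auto simp: partition_on_def disjoint_def)
      with False sub dom[OF Q z] show ?thesis by (auto simp: set_dist_neighbour)
    qed
  qed
  then have "partition_repr G Ps x = partition_repr G Ps y"
    by (simp add: partition_repr_def)
  with res xy show False by (auto simp: resolving_partition_def)
qed

end

text \<open>The only possible neighbour of either vertex is \<open>Inl v\<close>, which does not
  depend on \<open>x\<close> or \<open>y\<close>. For \<open>v\<close> outside
  \<open>pverts G\<close> neither has any arc.\<close>

lemma corona_isolated_twins: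
  assumes "x \<in> isolated_verts H" "y \<in> isolated_verts H"
  shows "(Inr (v, x), w) \<in> parcs (corona G H) \<longleftrightarrow> (Inr (v, y), w) \<in> parcs (corona G H)"
proof -
  have "z \<in> pverts H \<and> (\<forall>u. (z, u) \<notin> parcs H)" if "z \<in> isolated_verts H" for z
    using that by (force simp: isolated_verts_def out_arcs_def)
  with assms show ?thesis by (simp add: corona_def)
qed

text \<open>Turns pairwise separation into a bound on cardinalities. It serves both the isolated
  vertices in one copy of \<open>H\<close> and the vertices of \<open>G\<close>.\<close>

lemma partition_on_class_inj:
  assumes "partition_on V \<P>" "f ` A \<subseteq> V"
    and sep: "\<And>x y P. \<lbrakk>x \<in> A; y \<in> A; x \<noteq> y; P \<in> \<P>; f x \<in> P\<rbrakk> \<Longrightarrow> f y \<notin> P"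
  obtains c where "inj_on c A" "c ` A \<subseteq> \<P>" "\<And>x. x \<in> A \<Longrightarrow> f x \<in> c x"
proof -
  have "\<forall>x\<in>A. \<exists>P\<in>\<P>. f x \<in> P"
    using assms(1,2) by (auto simp: partition_on_def)
  then obtain c where c: "\<forall>x\<in>A. c x \<in> \<P> \<and> f x \<in> c x"
    by metis
  moreover have "inj_on c A"
    using c sep by (metis inj_onI)
  ultimately show ?thesis using that by blast
qed

theorem theorem14:
  fixes G :: "'a pair_pre_digraph" and H :: "'b pair_pre_digraph" and n :: nat
  assumes "pair_graph G" and "Digraph_Component.connected (with_proj G)"
    and "card (pverts G) = n" and "n \<ge> 2"
    and "pair_graph H"
    and "n > num_isolated H" and "num_isolated H \<ge> 2"
  shows "partition_dimension (corona G H) \<ge> num_isolated H + 1"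
proof (rule ccontr)
  interpret F: pair_graph "corona G H"
    using assms(1,5) by (rule pair_graph_corona)
  let ?F = "corona G H" and ?I = "isolated_verts H"
  assume "\<not> ?thesis"
  \<comment> \<open>The minimum in \<open>partition_dimension\<close> has a witness only because
    some resolving partition exists.\<close>
  moreover have "\<exists>t Ps. resolving_partition ?F Ps \<and> length Ps = t"
    using resolving_partition_exists[OF F.pair_graph] by blast
  then obtain Ps where res: "resolving_partition ?F Ps"
    and len: "length Ps = partition_dimension ?F"
    unfolding partition_dimension_def
    using LeastI_ex[of "\<lambda>t. \<exists>Ps. resolving_partition ?F Ps \<and> length Ps = t"] by blast
  \<comment> \<open>Being below \<open>num_isolated H + 1\<close> means being at most
    \<open>num_isolated H\<close>.\<close>
  ultimately have le: "card (set Ps) \<le> card ?I"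
    using card_length[of Ps] by (simp add: num_isolated_def)
  have part: "partition_on (pverts ?F) (set Ps)"
    using res by (simp add: resolving_partition_def ordered_partition_def)
  have IH: "?I \<subseteq> pverts H" by (auto simp: isolated_verts_def)
  have meets: "\<exists>u\<in>Q. (Inl v, u) \<in> parcs ?F" if v: "v \<in> pverts G" and Q: "Q \<in> set Ps" for v Q
  proof -
    have verts: "Inr (v, x) \<in> pverts ?F" if "x \<in> ?I" for x
      using that v IH by (auto simp: corona_def)
    have "Inr (v, y) \<notin> P"
      if "x \<in> ?I" "y \<in> ?I" "x \<noteq> y" "P \<in> set Ps" "Inr (v, x) \<in> P" for x y P
      using F.resolving_partition_separates_twins[OF res corona_isolated_twins] that verts
      by blast
    then obtain c where c: "inj_on c ?I" "c ` ?I \<subseteq> set Ps" "\<And>x. x \<in> ?I \<Longrightarrow> Inr (v, x) \<in> c x"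
      using partition_on_class_inj[OF part, of "\<lambda>x. Inr (v, x)" ?I] verts by blast
    \<comment> \<open>An injection into a finite set that is no larger than its domain is onto, so
      each class is the class of some isolated vertex in the copy at \<open>v\<close>.\<close>
    have "c ` ?I = set Ps"
      using c(1,2) le by (intro card_seteq) (auto simp: card_image)
    then obtain x where "x \<in> ?I" "Q = c x" using Q by blast
    moreover from \<open>x \<in> ?I\<close> have "(Inl v, Inr (v, x)) \<in> parcs ?F"
      using v IH by (auto simp: corona_def)
    ultimately show ?thesis using c(3) by blast
  qed
  have verts: "Inl v \<in> pverts ?F" if "v \<in> pverts G" for v
    using that by (auto simp: corona_def)
  have "Inl y \<notin> P"
    if "x \<in> pverts G" "y \<in> pverts G" "x \<noteq> y" "P \<in> set Ps" "Inl x \<in> P" for x y P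
    using that verts meets
    by (intro F.resolving_partition_separates_dominating[OF res, of "Inl x"]) auto
  moreover have "Inl ` pverts G \<subseteq> pverts ?F"
    using verts by (rule image_subsetI)
  ultimately obtain c where "inj_on c (pverts G)" "c ` pverts G \<subseteq> set Ps"
    using partition_on_class_inj[OF part, of Inl "pverts G"] by metis
  \<comment> \<open>Together with \<open>le\<close> this gives
    \<open>n \<le> num_isolated H\<close>, against the assumption.\<close>
  then have "card (pverts G) \<le> card (set Ps)"
    by (intro card_inj_on_le) auto
  with le assms(3,6) show False by (simp add: num_isolated_def)
qed

end
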